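(* Let $\rho$ be a Minkowski norm in $\mathbb{R}^d$ whose unit ball is a polytope with $k$ facets, and let $\mathcal{F}_1, \ldots, \mathcal{F}_{kd}$ be finite families of convex sets in $\mathbb{R}^d$. If $\bigcap_{i=1}^{kd}F_i$ has $\rho$-diameter at least $1$ for every $kd$-tuple $(F_i)_{i=1}^{kd}$ such that $F_i \in \mathcal{F}_i$ for each $i$, then there exists an index $l \in \{1,\dots,kd\}$ such that $\bigcap \mathcal{F}_l$ has $\rho$-diameter at least $1$. Moreover, the same statement is not true if $kd$ is replaced by $kd-1$; that is, there are finite families $\mathcal{F}_1,\dots,\mathcal{F}_{kd-1}$ of convex sets in $\mathbb{R}^d$ such that $\bigcap_{i=1}^{kd-1}F_i$ has $\rho$-diameter at least $1$ for every choice of $F_i\in\mathcal{F}_i$, $1\le i\le kd-1$, but $\bigcap\mathcal{F}_l$ has $\rho$-diameter less than $1$ for every $l\in\{1,\dots,kd-1\}$.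
   Context: For a compact convex set $K\subseteq\mathbb{R}^d$ with nonempty interior that is symmetric about the origin, the Minkowski norm of $K$ is $\rho_K(x)=\min\{t\ge 0 : x\in tK\}$; its unit ball is $K$. For a Minkowski norm $\rho$, the $\rho$-diameter of a set $A$ is $\sup_{x,y\in A}\rho(x-y)$. *)

theory Defs
  imports "HOL-Analysis.Analysis"
begin

definition symmetric_convex_body :: "'a::euclidean_space set \<Rightarrow> bool" where
  "symmetric_convex_body K \<longleftrightarrow>
     compact K \<and> convex K \<and> interior K \<noteq> {} \<and> (\<forall>x\<in>K. - x \<in> K)"

(* The minimum is attained whenever K is a symmetric convex body; LEAST is
   unspecified for sets K where it is not. *)
definition minkowski_norm :: "'a::euclidean_space set \<Rightarrow> 'a \<Rightarrow> real" where
  "minkowski_norm K x = (LEAST t. t \<ge> 0 \<and> x \<in> (\<lambda>z. t *\<^sub>R z) ` K)"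

(* Extended-real valued, so that unbounded sets have diameter \<infinity>. The empty set
   gets the value -\<infinity>; as for the convention 0, this is less than 1. *)
definition norm_diameter :: "('a::euclidean_space \<Rightarrow> real) \<Rightarrow> 'a set \<Rightarrow> ereal" where
  "norm_diameter \<rho> A = (SUP (x, y)\<in>A \<times> A. ereal (\<rho> (x - y)))"

end

theory Submission
  imports Defs
begin

text \<open>
  If \<open>K\<close> is given by the inequalities \<open>u \<bullet> x \<le> 1\<close>, where \<open>u\<close> ranges over the set \<open>N\<close> of
  its \<open>k\<close> scaled facet normals, then \<open>\<rho> z\<close> is the maximum of the \<open>u \<bullet> z\<close>.  So a set has a large
  diameter exactly when it is wide in the direction of some facet normal, and opposite normals give
  the same width; there are \<open>k / 2\<close> essentially different directions.

  For a single direction \<open>u\<close>, the pairs \<open>(x, y)\<close> of points of a convex set with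
  \<open>u \<bullet> (x - y) = t\<close> form a convex subset of a hyperplane in dimension \<open>2 * d\<close>.  The colourful Helly
  theorem in dimension \<open>2 * d - 1\<close> therefore handles this direction with \<open>2 * d\<close> colours
  (\<open>colourful_helly_hyperplane\<close>, \<open>colourful_width\<close>).  Giving each of the \<open>k / 2\<close> directions its
  own block of \<open>2 * d\<close> colours uses up the \<open>k * d\<close> colours: if no colour class had an intersection
  of diameter at least \<open>1\<close>, each block would contain a transversal that is too narrow in its
  direction, and together these would form a transversal of diameter less than \<open>1\<close>
  (\<open>colourful_diameter\<close>).

  Fewer colours do not suffice because there are \<open>k * d\<close> halfspaces whose intersection has diameter
  less than \<open>1\<close>, although the diameter reaches \<open>1\<close> as soon as any of them is dropped
  (\<open>critical_halfspaces\<close>): shrink \<open>K\<close> to slightly less than half its size and replace each of its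
  \<open>k\<close> facets by a flat simplicial cap with \<open>d\<close> sides whose apex lies on that facet.  With
  \<open>k * d - 1\<close> copies of this family, every transversal misses one of the halfspaces.
\<close>

section \<open>A colourful Helly theorem inside a hyperplane\<close>

lemma helly_indexed:
  fixes S :: "'i \<Rightarrow> 'b::euclidean_space set"
  assumes conv: "\<And>i. i \<in> I \<Longrightarrow> convex (S i)"
    and small: "\<And>J. J \<subseteq> I \<Longrightarrow> card J \<le> DIM('b) + 1 \<Longrightarrow> \<Inter>(S ` J) \<noteq> {}"
  shows "\<Inter>(S ` I) \<noteq> {}"
proof (cases "card (S ` I) \<ge> DIM('b) + 1")
  case True
  then show ?thesis
  proof (rule Helly)
    show "\<forall>s\<in>S ` I. convex s"
      using conv by blast
    fix t assume t: "t \<subseteq> S ` I" "card t = DIM('b) + 1"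
    then obtain J where "J \<subseteq> I" "inj_on S J" "t = S ` J"
      by (auto simp: subset_image_inj)
    with t show "\<Inter>t \<noteq> {}"
      using small[of J] by (simp add: card_image)
  qed
next
  case False
  obtain J where "J \<subseteq> I" "inj_on S J" "S ` I = S ` J"
    using subset_image_inj[of "S ` I" S I] by auto
  with False show ?thesis
    using small[of J] by (simp add: card_image)
qed

text \<open>
  A hyperplane lowers the Helly number by one.  Replace each set by its trace on the hyperplane
  coned off from a fixed point \<open>p\<close> beside the hyperplane, and add the hyperplane itself as one
  more set.  Subfamilies consisting of cones only meet in \<open>p\<close>, so the ordinary Helly number has to
  be checked only for subfamilies that spend one member on the hyperplane.
\<close>

lemma helly_hyperplane:
  fixes S :: "'i \<Rightarrow> 'b::euclidean_space set"
  assumes fin: "finite I" and w: "w \<noteq> 0" and H: "H = {z. w \<bullet> z = t}"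
    and conv: "\<And>i. i \<in> I \<Longrightarrow> convex (S i)"
    and small: "\<And>J. J \<subseteq> I \<Longrightarrow> card J \<le> DIM('b) \<Longrightarrow> \<exists>z\<in>H. \<forall>i\<in>J. z \<in> S i"
  shows "\<exists>z\<in>H. \<forall>i\<in>I. z \<in> S i"
proof -
  define p where "p = ((t + 1) / (w \<bullet> w)) *\<^sub>R w"
  have p: "w \<bullet> p = t + 1"
    using w by (simp add: p_def)
  define T where
    "T = (\<lambda>i. case i of None \<Rightarrow> H | Some i \<Rightarrow> convex hull (insert p (S i \<inter> H)))"
  have convH: "convex H"
    by (simp add: H convex_hyperplane)
  have trace: "z \<in> S i" if i: "i \<in> I" and z: "z \<in> H" "z \<in> T (Some i)" for i z
  proof -
    have "\<exists>z\<in>H. \<forall>j\<in>{i}. z \<in> S j"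
      using i by (intro small) (auto simp: Suc_le_eq)
    then have ne: "S i \<inter> H \<noteq> {}" by blast
    have hull: "convex hull (S i \<inter> H) = S i \<inter> H"
      using conv[OF i] convH by (simp add: convex_Int hull_same)
    obtain a b y where "a \<ge> 0" "b \<ge> 0" and ab: "a + b = 1"
      and y: "y \<in> S i \<inter> H" and zy: "z = a *\<^sub>R p + b *\<^sub>R y"
      using z(2) unfolding T_def by (auto simp: convex_hull_insert[OF ne] hull)
    have "t = a * (t + 1) + b * t"
      using z(1) y p unfolding H zy by (simp add: inner_add_right)
    also have "\<dots> = (a + b) * t + a"
      by (simp add: algebra_simps)
    finally have "a = 0"
      using ab by simp
    with ab y zy show ?thesis by simp
  qed
  have "\<Inter>(T ` insert None (Some ` I)) \<noteq> {}"
  proof (rule helly_indexed)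
    show "convex (T i)" for i
      by (cases i) (auto simp: T_def convH)
    fix J assume J: "J \<subseteq> insert None (Some ` I)" "card J \<le> DIM('b) + 1"
    show "\<Inter>(T ` J) \<noteq> {}"
    proof (cases "None \<in> J")
      case False
      have "p \<in> T i" if "i \<in> J" for i
        using that False by (cases i) (auto simp: T_def hull_inc)
      then show ?thesis by blast
    next
      case True
      define J' where "J' = {i. Some i \<in> J}"
      have J': "J' \<subseteq> I" "J = insert None (Some ` J')"
      proof -
        show "J' \<subseteq> I" using J(1) by (auto simp: J'_def)
        show "J = insert None (Some ` J')"
          using True unfolding J'_def by (auto simp: image_iff) (metis not_None_eq)
      qed
      have "finite J'"
        using J'(1) fin finite_subset by blast
      then have "card J = card J' + 1"
        by (simp add: J'(2) card_image)
      with J(2) J'(1) obtain z where z: "z \<in> H" "\<forall>i\<in>J'. z \<in> S i"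
        using small[of J'] by auto
      have "z \<in> T i" if "i \<in> J" for i
        using that z unfolding J'(2) by (auto simp: T_def intro!: hull_inc)
      then show ?thesis by blast
    qed
  qed
  then obtain z where z: "\<forall>i\<in>insert None (Some ` I). z \<in> T i" by blast
  then have "z \<in> H"
    by (simp add: T_def)
  with z trace show ?thesis by blast
qed

text \<open>
  The colourful theorem for closed sets.  Omit one colour \<open>j\<close>, choose one set of each other
  colour, and consider the distance from the origin to their common part in the hyperplane;
  suppose the choice makes this distance maximal.  Adding any set of colour \<open>j\<close> cannot increase
  the distance: Helly's theorem, applied together with the open ball whose radius is the new
  distance, shows that the new distance is already attained after dropping some colour.  As nearest
  points are unique, the nearest point of the maximal choice lies in every set of colour \<open>j\<close>.
\<close>

lemma colourful_helly_hyperplane_closed: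
  fixes C :: "'i \<Rightarrow> 's \<Rightarrow> 'b::euclidean_space set"
  assumes fin: "finite I" "\<And>i. i \<in> I \<Longrightarrow> finite (G i)" and card: "card I = DIM('b)"
    and w: "w \<noteq> 0" and H: "H = {z. w \<bullet> z = t}"
    and C: "\<And>i A. i \<in> I \<Longrightarrow> A \<in> G i \<Longrightarrow> convex (C i A) \<and> closed (C i A)"
    and trans: "\<And>f. f \<in> Pi\<^sub>E I G \<Longrightarrow> \<exists>z\<in>H. \<forall>i\<in>I. z \<in> C i (f i)"
    and ne: "Pi\<^sub>E I G \<noteq> {}"
  shows "\<exists>i\<in>I. \<exists>z\<in>H. \<forall>A\<in>G i. z \<in> C i A"
proof -
  define D where "D = (\<lambda>J f. H \<inter> (\<Inter>i\<in>J. C i (f i)))"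
  define q where "q = (\<lambda>J f. closest_point (D J f) 0)"
  have D: "convex (D J f)" "closed (D J f)" "D J f \<noteq> {}" "q J f \<in> D J f"
    "\<And>z. z \<in> D J f \<Longrightarrow> norm (q J f) \<le> norm z"
    if "J \<subseteq> I" "f \<in> Pi\<^sub>E I G" for J f
  proof -
    have "f i \<in> G i" if "i \<in> J" for i
      using that \<open>J \<subseteq> I\<close> \<open>f \<in> Pi\<^sub>E I G\<close> by auto
    then show c: "convex (D J f)" "closed (D J f)"
      unfolding D_def H using C that(1)
      by (auto intro!: convex_Int convex_hyperplane convex_INT closed_Int closed_hyperplane closed_INT)
    show "D J f \<noteq> {}"
      using trans[OF that(2)] that(1) unfolding D_def by blast
    then show "q J f \<in> D J f" "\<And>z. z \<in> D J f \<Longrightarrow> norm (q J f) \<le> norm z"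
      using closest_point_in_set[OF c(2)] closest_point_le[OF c(2), of _ 0]
      unfolding q_def by auto
  qed
  define P where "P = I \<times> Pi\<^sub>E I G"
  have "finite P"
    unfolding P_def using fin by (intro finite_cartesian_product finite_PiE) auto
  moreover have "I \<noteq> {}"
    using card by auto
  then have "P \<noteq> {}"
    using ne unfolding P_def by auto
  ultimately obtain x where "is_arg_min (\<lambda>(i, g). - norm (q (I - {i}) g)) (\<lambda>x. x \<in> P) x"
    using ex_is_arg_min_if_finite by blast
  then obtain j f where jf: "j \<in> I" "f \<in> Pi\<^sub>E I G"
    and max: "\<And>i g. i \<in> I \<Longrightarrow> g \<in> Pi\<^sub>E I G \<Longrightarrow> norm (q (I - {i}) g) \<le> norm (q (I - {j}) f)"
    unfolding is_arg_min_linorder P_def by (cases x) force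
  have "q (I - {j}) f \<in> C j A" if A: "A \<in> G j" for A
  proof -
    define g where "g = f(j := A)"
    have g: "g \<in> Pi\<^sub>E I G"
      using jf A unfolding g_def by (auto simp: PiE_iff extensional_def)
    define s where "s = norm (q I g)"
    have "\<exists>i\<in>I. D (I - {i}) g \<inter> ball 0 s = {}"
    proof (rule ccontr)
      assume contr: "\<not> ?thesis"
      define S where "S = (\<lambda>i. case i of None \<Rightarrow> ball 0 s | Some i \<Rightarrow> C i (g i))"
      have "\<exists>z\<in>H. \<forall>i\<in>insert None (Some ` I). z \<in> S i"
      proof (rule helly_hyperplane[OF _ w H])
        show "finite (insert None (Some ` I))"
          using fin by simp
        show "convex (S i)" if "i \<in> insert None (Some ` I)" for i
          using that C g by (auto simp: S_def PiE_iff)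
        fix J assume J: "J \<subseteq> insert None (Some ` I)" "card J \<le> DIM('b)"
        have "J \<noteq> insert None (Some ` I)"
          using J(2) card fin by (auto simp: card_image)
        then consider "None \<notin> J" | i where "i \<in> I" "Some i \<notin> J"
          using J(1) by blast
        then show "\<exists>z\<in>H. \<forall>i\<in>J. z \<in> S i"
        proof cases
          case 1
          have "q I g \<in> D I g"
            using D(4)[OF order_refl g] .
          with 1 J(1) show ?thesis
            unfolding D_def S_def by (intro bexI[of _ "q I g"]) auto
        next
          case 2
          with contr obtain z where "z \<in> D (I - {i}) g" "z \<in> ball 0 s"
            by blast
          with 2 J(1) show ?thesis
            unfolding D_def S_def by (intro bexI[of _ z]) (auto split: option.split)
        qed
      qed
      then obtain z where "z \<in> D I g" "norm z < s"
        unfolding S_def D_def by auto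
      with D(5)[OF order_refl g, of z] show False
        unfolding s_def by simp
    qed
    then obtain i where i: "i \<in> I" "D (I - {i}) g \<inter> ball 0 s = {}"
      by blast
    have "q (I - {i}) g \<in> D (I - {i}) g"
      using D(4)[of "I - {i}"] g by blast
    with i have "s \<le> norm (q (I - {i}) g)"
      by (metis disjoint_iff dist_0_norm mem_ball not_le)
    also have "\<dots> \<le> norm (q (I - {j}) f)"
      using max i(1) g by blast
    finally have le: "norm (q I g) \<le> norm (q (I - {j}) f)"
      by (simp add: s_def)
    have sub: "D I g \<subseteq> D (I - {j}) f" "D I g \<subseteq> C j A"
    proof -
      have "D (I - {j}) f = D (I - {j}) g"
        unfolding D_def g_def by (intro arg_cong2[where f = "(\<inter>)"] INF_cong) auto
      then show "D I g \<subseteq> D (I - {j}) f"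
        unfolding D_def by blast
      have "g j = A"
        by (simp add: g_def)
      then show "D I g \<subseteq> C j A"
        using jf(1) unfolding D_def by blast
    qed
    have qin: "q I g \<in> D I g"
      using D(4)[OF order_refl g] .
    have "q I g = closest_point (D (I - {j}) f) 0"
    proof (rule closest_point_unique)
      show "convex (D (I - {j}) f)" "closed (D (I - {j}) f)"
        using D(1,2)[of "I - {j}" f] jf(2) by auto
      show "q I g \<in> D (I - {j}) f"
        using qin sub by blast
      show "\<forall>z\<in>D (I - {j}) f. dist 0 (q I g) \<le> dist 0 z"
        using D(5)[of "I - {j}" f] jf(2) le by fastforce
    qed
    then have "q I g = q (I - {j}) f"
      by (simp add: q_def)
    with qin sub show ?thesis by auto
  qed
  moreover have "q (I - {j}) f \<in> H"
    using D(4)[of "I - {j}" f] jf(2) unfolding D_def by blast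
  ultimately show ?thesis
    using jf(1) by blast
qed

text \<open>
  Closedness costs nothing: pick a common point for each of the finitely many transversals and
  shrink every set to the convex hull of the points picked for the transversals through it.
\<close>

lemma colourful_helly_hyperplane:
  fixes C :: "'s \<Rightarrow> 'b::euclidean_space set"
  assumes fin: "finite I" "\<And>i. i \<in> I \<Longrightarrow> finite (G i)" and card: "card I = DIM('b)"
    and w: "w \<noteq> 0" and H: "H = {z. w \<bullet> z = t}"
    and conv: "\<And>i A. i \<in> I \<Longrightarrow> A \<in> G i \<Longrightarrow> convex (C A)"
    and trans: "\<And>f. f \<in> Pi\<^sub>E I G \<Longrightarrow> \<exists>z\<in>H. \<forall>i\<in>I. z \<in> C (f i)"
  shows "\<exists>i\<in>I. \<exists>z\<in>H. \<forall>A\<in>G i. z \<in> C A"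
proof (cases "Pi\<^sub>E I G = {}")
  case True
  then obtain i where "i \<in> I" "G i = {}"
    by (auto simp: PiE_eq_empty_iff)
  moreover have "(t / (w \<bullet> w)) *\<^sub>R w \<in> H"
    using w by (simp add: H)
  ultimately show ?thesis by blast
next
  case False
  obtain p where p: "\<And>f. f \<in> Pi\<^sub>E I G \<Longrightarrow> p f \<in> H \<and> (\<forall>i\<in>I. p f \<in> C (f i))"
    using trans by metis
  define B where "B = (\<lambda>i A. convex hull (p ` {f \<in> Pi\<^sub>E I G. f i = A}))"
  have finP: "finite (Pi\<^sub>E I G)"
    using fin by (intro finite_PiE) auto
  have B: "B i A \<subseteq> C A" if "i \<in> I" "A \<in> G i" for i A
    unfolding B_def using conv[OF that] that(1) p by (intro hull_minimal) auto
  have "\<exists>i\<in>I. \<exists>z\<in>H. \<forall>A\<in>G i. z \<in> B i A"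
  proof (rule colourful_helly_hyperplane_closed[OF fin card w H _ _ False])
    show "convex (B i A) \<and> closed (B i A)" for i A
      unfolding B_def using finP
      by (auto intro!: compact_imp_closed finite_imp_compact_convex_hull)
    fix f assume f: "f \<in> Pi\<^sub>E I G"
    then have "p f \<in> B i (f i)" for i
      unfolding B_def by (intro hull_inc) auto
    with p[OF f] show "\<exists>z\<in>H. \<forall>i\<in>I. z \<in> B i (f i)" by blast
  qed
  with B show ?thesis by blast
qed

section \<open>Facet normals and the Minkowski norm\<close>

lemma zero_in_interior_symmetric_convex_body:
  assumes "symmetric_convex_body K"
  shows "0 \<in> interior K"
proof -
  have K: "convex K" "interior K \<noteq> {}" "uminus ` K = K"
    using assms unfolding symmetric_convex_body_def by (auto simp: image_iff) (metis minus_minus)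
  then obtain x where x: "x \<in> interior K" by blast
  have "- x \<in> uminus ` interior K"
    using x by blast
  then have "- x \<in> interior K"
    using K(3) interior_negations[of K] by simp
  then have "(1/2) *\<^sub>R x + (1/2) *\<^sub>R (- x) \<in> interior K"
    using x K(1) by (intro convexD[OF convex_interior]) auto
  then show ?thesis by simp
qed

text \<open>
  A facet of a full-dimensional set spans the hyperplane that supports it, and a hyperplane off
  the origin has only one equation with right-hand side \<open>1\<close>.
\<close>

lemma facet_normal_unique:
  fixes K :: "'a::euclidean_space set"
  assumes "interior K \<noteq> {}" and S: "S facet_of K"
    and u: "S \<subseteq> {x. u \<bullet> x = 1}" and v: "S \<subseteq> {x. v \<bullet> x = 1}"
  shows "u = v"
proof -
  have ne: "S \<noteq> {}" and dim: "aff_dim S = int DIM('a) - 1"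
    using S aff_dim_nonempty_interior[OF assms(1)] by (auto simp: facet_of_def)
  have hyp: "affine hull S = {x. n \<bullet> x = 1}" if n: "S \<subseteq> {x. n \<bullet> x = 1}" for n
  proof (rule affine_dim_equal)
    have "n \<noteq> 0"
      using n ne by auto
    then show "aff_dim (affine hull S) = aff_dim {x. n \<bullet> x = 1}"
      using dim by simp
    show "affine hull S \<subseteq> {x. n \<bullet> x = 1}"
      using n by (intro hull_minimal affine_hyperplane)
  qed (use ne in \<open>auto simp: affine_hyperplane\<close>)
  then have eq: "{x. u \<bullet> x = 1} = {x. v \<bullet> x = 1}"
    using u v by metis
  have "u \<noteq> 0" "v \<noteq> 0"
    using u v ne by auto
  then have "u /\<^sub>R (u \<bullet> u) \<in> {x. u \<bullet> x = 1}" "v /\<^sub>R (v \<bullet> v) \<in> {x. v \<bullet> x = 1}"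
    by auto
  then have "v \<bullet> (u /\<^sub>R (u \<bullet> u)) = 1" "u \<bullet> (v /\<^sub>R (v \<bullet> v)) = 1"
    using eq by blast+
  then have "v \<bullet> u = u \<bullet> u" "u \<bullet> v = v \<bullet> v"
    using \<open>u \<noteq> 0\<close> \<open>v \<noteq> 0\<close> by (simp_all add: field_simps)
  then have "(u - v) \<bullet> (u - v) = 0"
    by (simp add: inner_diff inner_commute)
  then show ?thesis by simp
qed

text \<open>
  Scaled to right-hand side \<open>1\<close>, the facet inequalities describe \<open>K\<close>.  The last clause says that
  a relative interior point of a facet lies on no other facet.
\<close>

lemma facet_normals_exist:
  fixes K :: "'a::euclidean_space set"
  assumes sym: "symmetric_convex_body K" and poly: "polytope K"
  obtains N where "finite N" "card N = card {S. S facet_of K}"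
    "\<And>u. u \<in> N \<Longrightarrow> u \<noteq> 0" "\<And>u. u \<in> N \<Longrightarrow> - u \<in> N"
    "K = {x. \<forall>u\<in>N. u \<bullet> x \<le> 1}"
    "\<And>u. u \<in> N \<Longrightarrow> \<exists>p. u \<bullet> p = 1 \<and> (\<forall>v\<in>N - {u}. v \<bullet> p < 1)"
proof -
  have K: "bounded K" "convex K" "interior K \<noteq> {}" "uminus ` K = K"
    using sym unfolding symmetric_convex_body_def
    by (auto simp: compact_imp_bounded image_iff) (metis minus_minus)
  have polyh: "polyhedron K"
    using poly by (rule polytope_imp_polyhedron)
  have int0: "0 \<in> interior K"
    using sym by (rule zero_in_interior_symmetric_convex_body)
  have "\<exists>u. K \<subseteq> {x. u \<bullet> x \<le> 1} \<and> S = K \<inter> {x. u \<bullet> x = 1}" if S: "S facet_of K" for S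
  proof -
    obtain a b where a: "a \<noteq> 0" and ab: "K \<subseteq> {x. a \<bullet> x \<le> b}" "S = K \<inter> {x. a \<bullet> x = b}"
      using facet_of_polyhedron[OF polyh S] by blast
    have "0 \<in> interior {x. a \<bullet> x \<le> b}"
      using interior_mono[OF ab(1)] int0 by blast
    then have "b > 0"
      using a by (simp add: interior_halfspace_le)
    then have "K \<subseteq> {x. (a /\<^sub>R b) \<bullet> x \<le> 1}" "S = K \<inter> {x. (a /\<^sub>R b) \<bullet> x = 1}"
      using ab by (auto simp: field_simps)
    then show ?thesis by blast
  qed
  then obtain n where n: "\<And>S. S facet_of K \<Longrightarrow> K \<subseteq> {x. n S \<bullet> x \<le> 1}"
    "\<And>S. S facet_of K \<Longrightarrow> S = K \<inter> {x. n S \<bullet> x = 1}"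
    by metis
  define N where "N = n ` {S. S facet_of K}"
  have inj: "inj_on n {S. S facet_of K}"
    by (rule inj_onI) (metis mem_Collect_eq n(2))
  show thesis
  proof
    show "finite N"
      unfolding N_def using finite_polytope_facets[OF poly] by simp
    show "card N = card {S. S facet_of K}"
      unfolding N_def using inj by (rule card_image)
    fix u assume "u \<in> N"
    then obtain S where S: "S facet_of K" "u = n S"
      unfolding N_def by blast
    show "u \<noteq> 0"
      using S n(2)[of S] by (auto simp: facet_of_def)
    have lin: "linear (uminus :: 'a \<Rightarrow> 'a)"
      by (simp add: linear_uminus)
    have "(uminus ` S) facet_of (uminus ` K)"
      using S(1) unfolding facet_of_def
      by (simp add: face_of_linear_image[OF lin] aff_dim_injective_linear_image[OF lin])
    then have mS: "(uminus ` S) facet_of K"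
      using K(4) by simp
    have "n (uminus ` S) = - u"
    proof (rule facet_normal_unique[OF K(3) mS])
      show "uminus ` S \<subseteq> {x. n (uminus ` S) \<bullet> x = 1}"
        using n(2)[OF mS] by blast
      show "uminus ` S \<subseteq> {x. - u \<bullet> x = 1}"
        using n(2)[OF S(1)] S(2) by auto
    qed
    then show "- u \<in> N"
      unfolding N_def using mS by (metis imageI mem_Collect_eq)
    have "rel_interior S \<noteq> {}"
      using S(1) K(2) by (metis face_of_imp_convex facet_of_def rel_interior_eq_empty)
    then obtain p where p: "p \<in> rel_interior S" by blast
    then have pS: "p \<in> S"
      using rel_interior_subset by blast
    have "v \<bullet> p < 1" if vN: "v \<in> N" and vu: "v \<noteq> u" for v
    proof (rule ccontr)
      assume neg: "\<not> v \<bullet> p < 1"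
      obtain T where T: "T facet_of K" "v = n T"
        using vN unfolding N_def by blast
      have "p \<in> K"
        using pS n(2)[OF S(1)] by blast
      with neg have "p \<in> T"
        using n[OF T(1)] T(2) by fastforce
      then have "S \<subseteq> T"
        using p subset_of_face_of[OF facet_of_imp_face_of[OF T(1)] facet_of_imp_subset[OF S(1)]]
        by blast
      then have "S \<subseteq> {x. v \<bullet> x = 1}"
        using n(2)[OF T(1)] T(2) by blast
      moreover have "S \<subseteq> {x. u \<bullet> x = 1}"
        using n(2)[OF S(1)] S(2) by blast
      ultimately show False
        using facet_normal_unique[OF K(3) S(1)] vu by metis
    qed
    moreover have "u \<bullet> p = 1"
      using pS n(2)[OF S(1)] S(2) by blast
    ultimately show "\<exists>p. u \<bullet> p = 1 \<and> (\<forall>v\<in>N - {u}. v \<bullet> p < 1)"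
      by blast
  next
    have "x \<in> K" if x: "\<forall>u\<in>N. u \<bullet> x \<le> 1" for x
    proof (rule ccontr)
      assume notin: "x \<notin> K"
      then have "x \<noteq> 0"
        using int0 interior_subset by blast
      \<comment> \<open>The ray from the centre to \<open>x\<close> leaves \<open>K\<close> before \<open>x\<close>, through a facet that \<open>x\<close> violates.\<close>
      with ray_to_frontier[OF K(1) int0, of x] obtain r where r: "0 < r" "r *\<^sub>R x \<in> frontier K"
        "\<And>e. 0 \<le> e \<Longrightarrow> e < r \<Longrightarrow> e *\<^sub>R x \<in> interior K"
        by auto
      have "r *\<^sub>R x \<in> rel_frontier K"
        using r(2) K(3) by (simp add: rel_frontier_nonempty_interior)
      then obtain S where S: "S facet_of K" "r *\<^sub>R x \<in> S"
        using rel_frontier_of_polyhedron[OF polyh] by auto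
      have "r *\<^sub>R x \<in> K" "n S \<bullet> (r *\<^sub>R x) = 1"
        using n(2)[OF S(1)] S(2) by blast+
      moreover have "r \<le> 1"
        using r(3)[of 1] notin interior_subset[of K] by (cases "1 < r") auto
      moreover have "r \<noteq> 1"
        using calculation(1) notin by auto
      moreover have "r * (n S \<bullet> x) \<le> r * 1"
        using x S(1) r(1) unfolding N_def by (intro mult_left_mono) auto
      ultimately show False by simp
    qed
    moreover have "u \<bullet> x \<le> 1" if "x \<in> K" "u \<in> N" for u x
      using that n(1) unfolding N_def by blast
    ultimately show "K = {x. \<forall>u\<in>N. u \<bullet> x \<le> 1}"
      by blast
  qed
qed

lemma minkowski_norm_eq_Max:
  fixes K :: "'a::euclidean_space set"
  assumes bd: "bounded K" and fin: "finite N" and sym: "\<And>u. u \<in> N \<Longrightarrow> - u \<in> N"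
    and K: "K = {x. \<forall>u\<in>N. u \<bullet> x \<le> 1}"
  shows "N \<noteq> {}" and "minkowski_norm K z = Max ((\<lambda>u. u \<bullet> z) ` N)"
proof -
  show ne: "N \<noteq> {}"
    using bd not_bounded_UNIV unfolding K by auto
  define M where "M = Max ((\<lambda>u. u \<bullet> z) ` N)"
  have le: "u \<bullet> z \<le> M" if "u \<in> N" for u
    unfolding M_def using that fin by (intro Max_ge) auto
  have M0: "M \<ge> 0"
  proof -
    obtain u where u: "u \<in> N"
      using ne by blast
    show ?thesis
      using le[OF u] le[OF sym[OF u]] by simp
  qed
  have "minkowski_norm K z = M"
    unfolding minkowski_norm_def
  proof (rule Least_equality)
    have "z \<in> (\<lambda>x. M *\<^sub>R x) ` K"
    proof (cases "M = 0")
      case True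
      have "z = 0"
      proof (rule ccontr)
        assume "z \<noteq> 0"
        obtain B where B: "B > 0" "\<And>x. x \<in> K \<Longrightarrow> norm x \<le> B"
          using bd bounded_pos by blast
        have "((B + 1) / norm z) *\<^sub>R z \<in> K"
        proof -
          have "((B + 1) / norm z) * (u \<bullet> z) \<le> 0" if "u \<in> N" for u
            using le[OF that] True B(1) by (intro mult_nonneg_nonpos) auto
          then show ?thesis
            unfolding K by (fastforce)
        qed
        then have "norm (((B + 1) / norm z) *\<^sub>R z) \<le> B"
          by (rule B(2))
        with \<open>z \<noteq> 0\<close> B(1) show False by simp
      qed
      moreover have "0 \<in> K"
        unfolding K by simp
      ultimately show ?thesis
        by (auto simp: image_iff intro: bexI[of _ 0])
    next
      case False
      with M0 have "M > 0" by simp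
      then have "z /\<^sub>R M \<in> K" "z = M *\<^sub>R (z /\<^sub>R M)"
        unfolding K using le by (auto simp: field_simps)
      then show ?thesis by blast
    qed
    with M0 show "0 \<le> M \<and> z \<in> (\<lambda>x. M *\<^sub>R x) ` K" by blast
  next
    fix t assume t: "0 \<le> t \<and> z \<in> (\<lambda>x. t *\<^sub>R x) ` K"
    then obtain x where x: "x \<in> K" "z = t *\<^sub>R x" by blast
    have "u \<bullet> z \<le> t" if "u \<in> N" for u
      using x that t mult_left_mono[of "u \<bullet> x" 1 t] unfolding K by auto
    then show "M \<le> t"
      unfolding M_def using fin ne by simp
  qed
  then show "minkowski_norm K z = Max ((\<lambda>u. u \<bullet> z) ` N)"
    by (simp add: M_def)
qed

lemma norm_diameter_mono: "A \<subseteq> B \<Longrightarrow> norm_diameter \<rho> A \<le> norm_diameter \<rho> B"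
  unfolding norm_diameter_def by (intro SUP_subset_mono) auto

lemma norm_diameter_ge: "x \<in> A \<Longrightarrow> y \<in> A \<Longrightarrow> ereal (\<rho> (x - y)) \<le> norm_diameter \<rho> A"
  unfolding norm_diameter_def by (intro SUP_upper2[of "(x, y)"]) auto

section \<open>The colourful diameter theorem\<close>

lemma convex_attains_smaller_width:
  fixes A :: "'a::real_inner set"
  assumes "convex A" "x \<in> A" "y \<in> A" and t: "0 \<le> t" "t \<le> u \<bullet> (x - y)"
  shows "\<exists>x'\<in>A. u \<bullet> (x' - y) = t"
proof (cases "u \<bullet> (x - y) = 0")
  case True
  then show ?thesis
    using assms by (intro bexI[of _ x]) auto
next
  case False
  define r where "r = t / (u \<bullet> (x - y))"
  have r: "0 \<le> r" "r \<le> 1"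
    using t False by (auto simp: r_def field_simps)
  have "(1 - r) *\<^sub>R y + r *\<^sub>R x \<in> A"
    using assms r by (intro convexD) auto
  moreover have "(1 - r) *\<^sub>R y + r *\<^sub>R x - y = r *\<^sub>R (x - y)"
    by (simp add: algebra_simps)
  then have "u \<bullet> ((1 - r) *\<^sub>R y + r *\<^sub>R x - y) = t"
    using False by (simp only: inner_scaleR_right) (simp add: r_def)
  ultimately show ?thesis by blast
qed

text \<open>
  A pair of points witnessing width \<open>t\<close> in direction \<open>u\<close> is a point of the product of a set with
  itself.  Convexity allows the width to be exactly \<open>t\<close>, which confines the pairs to a hyperplane
  of a space of dimension twice \<open>DIM('a)\<close>; this is where the number of colours comes from.
\<close>

lemma colourful_width:
  fixes G :: "'i \<Rightarrow> 'a::euclidean_space set set"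
  assumes fin: "finite I" "\<And>i. i \<in> I \<Longrightarrow> finite (G i)" and card: "card I = 2 * DIM('a)"
    and u: "u \<noteq> 0" and t: "0 \<le> t"
    and conv: "\<And>i A. i \<in> I \<Longrightarrow> A \<in> G i \<Longrightarrow> convex A"
    and trans: "\<And>f. f \<in> Pi\<^sub>E I G \<Longrightarrow> \<exists>x y. x \<in> \<Inter>(f ` I) \<and> y \<in> \<Inter>(f ` I) \<and> t \<le> u \<bullet> (x - y)"
  shows "\<exists>i\<in>I. \<exists>x\<in>\<Inter>(G i). \<exists>y\<in>\<Inter>(G i). u \<bullet> (x - y) = t"
proof -
  define H :: "('a \<times> 'a) set" where "H = {z. (u, - u) \<bullet> z = t}"
  have H: "(x, y) \<in> H \<longleftrightarrow> u \<bullet> (x - y) = t" for x y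
    by (simp add: H_def inner_diff_right)
  have "\<exists>i\<in>I. \<exists>z\<in>H. \<forall>A\<in>G i. z \<in> A \<times> A"
  proof (rule colourful_helly_hyperplane[OF fin])
    show "card I = DIM('a \<times> 'a)" "(u, - u) \<noteq> 0"
      using card u by (simp_all add: prod_eq_iff)
    show "H = {z. (u, - u) \<bullet> z = t}"
      by (rule H_def)
    show "convex (A \<times> A)" if "i \<in> I" "A \<in> G i" for i A
      using conv[OF that] by (intro convex_Times)
    fix f assume f: "f \<in> Pi\<^sub>E I G"
    obtain x y where xy: "x \<in> \<Inter>(f ` I)" "y \<in> \<Inter>(f ` I)" "t \<le> u \<bullet> (x - y)"
      using trans[OF f] by blast
    have "convex (\<Inter>(f ` I))"
      using conv f by (intro convex_INT) (auto simp: PiE_iff)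
    then obtain x' where "x' \<in> \<Inter>(f ` I)" "u \<bullet> (x' - y) = t"
      using convex_attains_smaller_width xy t by blast
    with xy(2) have "(x', y) \<in> H" "\<forall>i\<in>I. (x', y) \<in> f i \<times> f i"
      by (auto simp: H)
    then show "\<exists>z\<in>H. \<forall>i\<in>I. z \<in> f i \<times> f i"
      by blast
  qed
  then obtain i z where "i \<in> I" "z \<in> H" "\<forall>A\<in>G i. z \<in> A \<times> A"
    by blast
  then show ?thesis
    using H by (cases z) blast
qed

text \<open>
  Each pair of opposite facet normals receives the \<open>2 * DIM('a)\<close> colours labelled by that pair and
  by \<open>Basis\<close>.  If no colour had an intersection of diameter at least \<open>1\<close>, then some \<open>t < 1\<close> would
  exceed all those diameters, every block of colours would have a transversal of width less than
  \<open>t\<close> in the direction of its own normals, and gluing these would give a transversal of diameter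
  at most \<open>t\<close>.  Passing to \<open>t\<close> also takes care of suprema that are not attained.
\<close>

lemma colourful_diameter:
  fixes G :: "'i \<Rightarrow> 'a::euclidean_space set set"
  assumes N: "finite N" "\<And>u. u \<in> N \<Longrightarrow> u \<noteq> 0" "\<And>u. u \<in> N \<Longrightarrow> - u \<in> N"
    and \<rho>_ge: "\<And>u z. u \<in> N \<Longrightarrow> u \<bullet> z \<le> \<rho> z"
    and \<rho>_le: "\<And>z c. (\<And>u. u \<in> N \<Longrightarrow> u \<bullet> z \<le> c) \<Longrightarrow> \<rho> z \<le> c"
    and fin: "finite I" "\<And>i. i \<in> I \<Longrightarrow> finite (G i)" and card: "card I = card N * DIM('a)"
    and conv: "\<And>i A. i \<in> I \<Longrightarrow> A \<in> G i \<Longrightarrow> convex A"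
    and trans: "\<And>f. (\<And>i. i \<in> I \<Longrightarrow> f i \<in> G i) \<Longrightarrow> norm_diameter \<rho> (\<Inter>(f ` I)) \<ge> 1"
  shows "\<exists>i\<in>I. norm_diameter \<rho> (\<Inter>(G i)) \<ge> 1"
proof (rule ccontr)
  assume "\<not> ?thesis"
  then have less: "norm_diameter \<rho> (\<Inter>(G i)) < 1" if "i \<in> I" for i
    using that by force
  \<comment> \<open>Inserting \<open>0\<close> makes the maximum real: empty intersections have diameter \<open>- \<infinity>\<close>.\<close>
  define M where "M = Max (insert 0 ((\<lambda>i. norm_diameter \<rho> (\<Inter>(G i))) ` I))"
  have "M < 1"
    unfolding M_def using fin(1) less by (subst Max_less_iff) auto
  then obtain t where t: "M < ereal t" "ereal t < 1"
    using ereal_dense2 by blast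
  have "0 \<le> M" and le_M: "\<And>i. i \<in> I \<Longrightarrow> norm_diameter \<rho> (\<Inter>(G i)) \<le> M"
    unfolding M_def using fin(1) by (auto intro!: Max_ge)
  then have t0: "0 \<le> t"
    using t(1) by (metis ereal_less_eq(5) less_imp_le order_trans)
  have "card (N \<times> (Basis :: 'a set)) = card I"
    by (simp add: card card_cartesian_product)
  then obtain h where h: "bij_betw h (N \<times> (Basis :: 'a set)) I"
    using finite_same_card_bij[of "N \<times> (Basis :: 'a set)" I] fin(1) N(1) by auto
  define block where "block = (\<lambda>Q. h ` (Q \<times> (Basis :: 'a set)))"
  have "\<exists>f. (\<forall>i\<in>block {u, - u}. f i \<in> G i) \<and>
      (\<forall>x y. x \<in> \<Inter>(f ` block {u, - u}) \<longrightarrow> y \<in> \<Inter>(f ` block {u, - u}) \<longrightarrow> u \<bullet> (x - y) < t)"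
    if u: "u \<in> N" for u
  proof -
    have sub: "{u, - u} \<times> Basis \<subseteq> N \<times> Basis"
      using u N(3) by auto
    then have block_I: "block {u, - u} \<subseteq> I"
      using h unfolding block_def bij_betw_def by blast
    have "u \<noteq> - u"
      using N(2)[OF u] by (simp add: eq_neg_iff_add_eq_0 flip: scaleR_2)
    then have card_block: "card (block {u, - u}) = 2 * DIM('a)"
      unfolding block_def
      using card_image[OF inj_on_subset[OF bij_betw_imp_inj_on[OF h] sub]]
      by (simp add: card_cartesian_product)
    show ?thesis
    proof (rule ccontr)
      assume contr: "\<not> ?thesis"
      have "\<exists>i\<in>block {u, - u}. \<exists>x\<in>\<Inter>(G i). \<exists>y\<in>\<Inter>(G i). u \<bullet> (x - y) = t"
      proof (rule colourful_width[OF _ _ card_block N(2)[OF u] t0])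
        show "finite (block {u, - u})" "\<And>i. i \<in> block {u, - u} \<Longrightarrow> finite (G i)"
          "\<And>i A. i \<in> block {u, - u} \<Longrightarrow> A \<in> G i \<Longrightarrow> convex A"
          using block_I fin conv finite_subset by blast+
        fix f assume f: "f \<in> Pi\<^sub>E (block {u, - u}) G"
        then have "\<forall>i\<in>block {u, - u}. f i \<in> G i"
          by (auto simp: PiE_iff)
        with contr show "\<exists>x y. x \<in> \<Inter>(f ` block {u, - u}) \<and> y \<in> \<Inter>(f ` block {u, - u}) \<and>
            t \<le> u \<bullet> (x - y)"
          by (meson not_le)
      qed
      then obtain i x y where i: "i \<in> block {u, - u}"
        and xy: "x \<in> \<Inter>(G i)" "y \<in> \<Inter>(G i)" "u \<bullet> (x - y) = t"
        by blast
      have "ereal t \<le> ereal (\<rho> (x - y))"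
        using \<rho>_ge[OF u, of "x - y"] xy(3) by simp
      also have "\<dots> \<le> norm_diameter \<rho> (\<Inter>(G i))"
        using xy by (intro norm_diameter_ge)
      also have "\<dots> \<le> M"
        using le_M block_I i by blast
      finally show False
        using t(1) by simp
    qed
  qed
  then obtain f where f: "\<And>u i. u \<in> N \<Longrightarrow> i \<in> block {u, - u} \<Longrightarrow> f u i \<in> G i"
    "\<And>u x y. u \<in> N \<Longrightarrow> x \<in> \<Inter>(f u ` block {u, - u}) \<Longrightarrow> y \<in> \<Inter>(f u ` block {u, - u}) \<Longrightarrow>
      u \<bullet> (x - y) < t"
    by metis
  \<comment> \<open>Opposite normals share a block, so one of the two must be singled out to choose for it.\<close>
  define rep where "rep = (\<lambda>u :: 'a. SOME v. v \<in> {u, - u})"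
  have rep: "rep u = u \<or> rep u = - u" "rep (- u) = rep u" for u :: 'a
  proof -
    show "rep u = u \<or> rep u = - u"
      unfolding rep_def using someI[of "\<lambda>v. v \<in> {u, - u}" u] by auto
    show "rep (- u) = rep u"
    proof -
      have "{- u, - (- u)} = {u, - u}" by auto
      then show ?thesis by (simp only: rep_def)
    qed
  qed
  define F where "F = (\<lambda>i. f (rep (fst (inv_into (N \<times> Basis) h i))) i)"
  have F: "F (h (u, b)) = f (rep u) (h (u, b))" if "u \<in> N" "b \<in> Basis" for u b
    using that h unfolding F_def by (simp add: bij_betw_def inv_into_f_f)
  have F_block: "F i = f (rep u) i" if "u \<in> N" "i \<in> block {u, - u}" for u i
    using that F[of u] F[of "- u"] N(3) rep(2) unfolding block_def by auto
  have rep_N: "rep u \<in> N" "block {rep u, - rep u} = block {u, - u}" if "u \<in> N" for u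
    using rep(1)[of u] that N(3) by (auto simp: insert_commute)
  have "F i \<in> G i" if i: "i \<in> I" for i
  proof -
    obtain u b where "u \<in> N" "b \<in> Basis" "i = h (u, b)"
      using i h unfolding bij_betw_def by auto
    then show ?thesis
      using F[of u b] f(1)[of "rep u" i] rep_N[of u] by (auto simp: block_def)
  qed
  then have "norm_diameter \<rho> (\<Inter>(F ` I)) \<ge> 1"
    by (rule trans)
  with t(2) have "ereal t < norm_diameter \<rho> (\<Inter>(F ` I))"
    by (rule less_le_trans)
  then obtain x y where xy: "x \<in> \<Inter>(F ` I)" "y \<in> \<Inter>(F ` I)" "t < \<rho> (x - y)"
    unfolding norm_diameter_def by (auto simp: less_SUP_iff)
  have "u \<bullet> (x - y) \<le> t" if u: "u \<in> N" for u
  proof -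
    have "block {u, - u} \<subseteq> I"
      using h u N(3) unfolding block_def bij_betw_def by blast
    then have "x \<in> \<Inter>(F ` block {u, - u})" "y \<in> \<Inter>(F ` block {u, - u})"
      using xy by blast+
    moreover have "F ` block {u, - u} = f (rep u) ` block {u, - u}"
      using F_block[OF u] by (intro image_cong) auto
    ultimately have in_f: "x \<in> \<Inter>(f (rep u) ` block {u, - u})"
        "y \<in> \<Inter>(f (rep u) ` block {u, - u})"
      by simp_all
    then have "rep u \<bullet> (x - y) < t" "rep u \<bullet> (y - x) < t"
      using f(2)[OF rep_N(1)[OF u]] rep_N(2)[OF u] by auto
    then show ?thesis
      using rep(1)[of u] by (auto simp: inner_diff_right)
  qed
  then have "\<rho> (x - y) \<le> t"
    by (rule \<rho>_le)
  with xy(3) show False by simp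
qed

section \<open>Optimality of the number of colours\<close>

text \<open>
  The signs orient the basis so that a nonzero \<open>u\<close> is not orthogonal to the sum of the basis; the
  escape direction constructed below divides by that inner product.
\<close>

definition basis_sign :: "'a::euclidean_space \<Rightarrow> 'a \<Rightarrow> real" where
  "basis_sign u b = (if u \<bullet> b \<ge> 0 then 1 else - 1)"

definition basis_sign_sum :: "'a::euclidean_space \<Rightarrow> 'a" where
  "basis_sign_sum u = (\<Sum>b\<in>Basis. basis_sign u b *\<^sub>R b)"

text \<open>
  The vectors added to \<open>u\<close> are the vertices of a small simplex centred at the origin.
\<close>

definition tilted_normal :: "real \<Rightarrow> 'a::euclidean_space \<Rightarrow> 'a \<Rightarrow> 'a" where
  "tilted_normal \<epsilon> u b =
     u + \<epsilon> *\<^sub>R (basis_sign u b *\<^sub>R b - (1 / real DIM('a)) *\<^sub>R basis_sign_sum u)"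

lemma basis_sign_square [simp]: "basis_sign u b * basis_sign u b = 1"
  by (simp add: basis_sign_def)

lemma sum_tilted_normal:
  fixes u :: "'a::euclidean_space"
  shows "(\<Sum>b\<in>Basis. tilted_normal \<epsilon> u b) = real DIM('a) *\<^sub>R u"
proof -
  have "(\<Sum>b\<in>Basis. tilted_normal \<epsilon> u b) = real DIM('a) *\<^sub>R u +
      \<epsilon> *\<^sub>R (basis_sign_sum u - real DIM('a) *\<^sub>R ((1 / real DIM('a)) *\<^sub>R basis_sign_sum u))"
    unfolding tilted_normal_def
    by (simp add: sum.distrib sum_subtractf basis_sign_sum_def sum_constant_scaleR
        flip: scaleR_sum_right)
  then show ?thesis by simp
qed

text \<open>
  The tilted normals are linearly independent, so a direction in which \<open>u\<close> increases can be chosen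
  inside all but one of the hyperplanes that they define.
\<close>

lemma tilted_normal_escape:
  fixes u :: "'a::euclidean_space"
  assumes u: "u \<noteq> 0" and \<epsilon>: "\<epsilon> \<noteq> 0" and b: "b \<in> Basis"
  shows "\<exists>e. u \<bullet> e = 1 \<and> (\<forall>c\<in>Basis - {b}. tilted_normal \<epsilon> u c \<bullet> e = 0)"
proof -
  let ?s = "basis_sign_sum u" and ?d = "real DIM('a)"
  have s_basis: "?s \<bullet> c = basis_sign u c" if "c \<in> Basis" for c
    using that unfolding basis_sign_sum_def by (simp add: inner_sum_left_Basis)
  have s_s: "?s \<bullet> ?s = ?d"
  proof -
    have "?s \<bullet> ?s = (\<Sum>c\<in>Basis. basis_sign u c * (?s \<bullet> c))"
      by (subst (2) basis_sign_sum_def) (simp add: inner_sum_right)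
    also have "\<dots> = (\<Sum>c\<in>(Basis :: 'a set). 1)"
      by (intro sum.cong) (simp_all add: s_basis)
    finally show ?thesis by simp
  qed
  have "u \<bullet> ?s = (\<Sum>c\<in>Basis. \<bar>u \<bullet> c\<bar>)"
    unfolding basis_sign_sum_def inner_sum_right
    by (intro sum.cong) (auto simp: basis_sign_def)
  moreover have "(\<Sum>c\<in>Basis. \<bar>u \<bullet> c\<bar>) \<noteq> 0"
    using u by (subst sum_nonneg_eq_0_iff) (auto simp: euclidean_all_zero_iff)
  ultimately have us: "u \<bullet> ?s \<noteq> 0" by simp
  \<comment> \<open>A multiple of \<open>b\<close> has the required products with the tilted normals up to a common constant;
    a multiple of the sign sum, to which the added simplex vectors are orthogonal, corrects it.\<close>
  define \<kappa> where "\<kappa> = (1 - (?d / \<epsilon>) * (basis_sign u b * (u \<bullet> b))) / (u \<bullet> ?s)"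
  define e where "e = \<kappa> *\<^sub>R ?s + ((?d / \<epsilon>) * basis_sign u b) *\<^sub>R b"
  have ue: "u \<bullet> e = 1"
    using us unfolding e_def \<kappa>_def by (simp add: inner_add_right)
  have se: "?s \<bullet> e = \<kappa> * ?d + ?d / \<epsilon>"
    unfolding e_def using s_s s_basis[OF b] by (simp add: inner_add_right)
  have "tilted_normal \<epsilon> u c \<bullet> e = 0" if c: "c \<in> Basis" "c \<noteq> b" for c
  proof -
    have "c \<bullet> e = \<kappa> * basis_sign u c"
      unfolding e_def using s_basis[OF c(1)] c b
      by (simp add: inner_add_right inner_not_same_Basis inner_commute)
    then have ce: "basis_sign u c * (c \<bullet> e) = \<kappa>"
      by simp
    have "tilted_normal \<epsilon> u c \<bullet> e = u \<bullet> e + \<epsilon> * (basis_sign u c * (c \<bullet> e) - (?s \<bullet> e) / ?d)"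
      unfolding tilted_normal_def by (simp add: inner_add_left inner_diff_left)
    also have "\<dots> = 0"
      unfolding ce ue se using \<epsilon> by (simp add: field_simps)
    finally show ?thesis .
  qed
  with ue show ?thesis by blast
qed

text \<open>
  Start from half of the unit ball, which has diameter exactly \<open>1\<close>, shrink it by a small
  \<open>\<delta>\<close>, and replace each facet by \<open>DIM('a)\<close> halfspaces tilted slightly about a
  point of that facet only.  The sum of the tilted normals is a multiple of the facet normal, so the
  tilted halfspaces still imply the facet inequality and the total intersection has diameter less
  than \<open>1\<close>.  Without one of them, the escape direction leads out of the facet, and for small tilts
  and small \<open>\<delta>\<close> the halfspaces at other facets do not interfere before the diameter reaches \<open>1\<close>.
\<close>

lemma critical_halfspaces:
  fixes N :: "'a::euclidean_space set"
  assumes N: "finite N" "\<And>u. u \<in> N \<Longrightarrow> u \<noteq> 0" "\<And>u. u \<in> N \<Longrightarrow> - u \<in> N"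
    and \<rho>_ge: "\<And>u z. u \<in> N \<Longrightarrow> u \<bullet> z \<le> \<rho> z"
    and \<rho>_le: "\<And>z c. (\<And>u. u \<in> N \<Longrightarrow> u \<bullet> z \<le> c) \<Longrightarrow> \<rho> z \<le> c"
    and facet: "\<And>u. u \<in> N \<Longrightarrow> \<exists>p. u \<bullet> p = 1 \<and> (\<forall>v\<in>N - {u}. v \<bullet> p < 1)"
  obtains S :: "'a \<times> 'a \<Rightarrow> 'a set" where
    "\<And>q. convex (S q)"
    "\<And>q. q \<in> N \<times> Basis \<Longrightarrow> norm_diameter \<rho> (\<Inter>(S ` (N \<times> Basis - {q}))) \<ge> 1"
    "norm_diameter \<rho> (\<Inter>(S ` (N \<times> Basis))) < 1"
proof -
  obtain p where p: "\<And>u. u \<in> N \<Longrightarrow> u \<bullet> p u = 1"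
    "\<And>u v. u \<in> N \<Longrightarrow> v \<in> N \<Longrightarrow> v \<noteq> u \<Longrightarrow> v \<bullet> p u < 1"
    using facet by (metis Diff_iff singletonD)
  have "\<forall>\<^sub>F \<epsilon> in at_right 0. \<forall>u\<in>N. \<forall>v\<in>N. \<forall>b\<in>Basis.
      u \<noteq> v \<longrightarrow> 0 < tilted_normal \<epsilon> v b \<bullet> (p v - p u)"
  proof (intro eventually_ball_finite ballI N(1) finite_Basis)
    fix u v b :: 'a assume uv: "u \<in> N" "v \<in> N" "b \<in> Basis"
    have "((\<lambda>\<epsilon>. tilted_normal \<epsilon> v b \<bullet> (p v - p u)) \<longlongrightarrow>
        tilted_normal 0 v b \<bullet> (p v - p u)) (at_right 0)"
      unfolding tilted_normal_def by (intro tendsto_intros)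
    moreover have "tilted_normal 0 v b \<bullet> (p v - p u) > 0" if "u \<noteq> v"
      using p(1)[of v] p(2)[of u v] uv that by (simp add: tilted_normal_def inner_diff_right)
    ultimately show "\<forall>\<^sub>F \<epsilon> in at_right 0. u \<noteq> v \<longrightarrow> 0 < tilted_normal \<epsilon> v b \<bullet> (p v - p u)"
      by (cases "u = v") (auto intro: order_tendstoD(1))
  qed
  then have "\<forall>\<^sub>F \<epsilon> in at_right 0. (0::real) < \<epsilon> \<and> (\<forall>u\<in>N. \<forall>v\<in>N. \<forall>b\<in>Basis.
      u \<noteq> v \<longrightarrow> 0 < tilted_normal \<epsilon> v b \<bullet> (p v - p u))"
    by (intro eventually_conj eventually_at_right_less)
  then obtain \<epsilon> :: real where \<epsilon>: "0 < \<epsilon>"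
    "\<And>u v b. u \<in> N \<Longrightarrow> v \<in> N \<Longrightarrow> b \<in> Basis \<Longrightarrow> u \<noteq> v \<Longrightarrow>
      0 < tilted_normal \<epsilon> v b \<bullet> (p v - p u)"
    using eventually_happens'[OF trivial_limit_at_right_real] by blast
  let ?n = "tilted_normal \<epsilon>"
  have "\<forall>u\<in>N. \<forall>b\<in>Basis. \<exists>e. u \<bullet> e = 1 \<and> (\<forall>c\<in>Basis - {b}. ?n u c \<bullet> e = 0)"
    using N(2) \<epsilon>(1) by (intro ballI tilted_normal_escape) auto
  then obtain e where e: "\<And>u b. u \<in> N \<Longrightarrow> b \<in> Basis \<Longrightarrow> u \<bullet> e u b = 1"
    "\<And>u b c. u \<in> N \<Longrightarrow> b \<in> Basis \<Longrightarrow> c \<in> Basis \<Longrightarrow> c \<noteq> b \<Longrightarrow> ?n u c \<bullet> e u b = 0"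
    by (metis Diff_iff singletonD)
  have "\<forall>\<^sub>F \<delta> in at_right 0. \<forall>u\<in>N. \<forall>v\<in>N. \<forall>b\<in>Basis. \<forall>c\<in>Basis. u \<noteq> v \<longrightarrow>
      0 < (1/2 - \<delta>) * (?n v c \<bullet> (p v - p u)) - 2 * \<delta> * (?n v c \<bullet> e u b)"
  proof (intro eventually_ball_finite ballI N(1) finite_Basis)
    fix u v b c :: 'a assume uv: "u \<in> N" "v \<in> N" "b \<in> Basis" "c \<in> Basis"
    have lim: "((\<lambda>\<delta>. (1/2 - \<delta>) * (?n v c \<bullet> (p v - p u)) - 2 * \<delta> * (?n v c \<bullet> e u b)) \<longlongrightarrow>
        (1/2 - 0) * (?n v c \<bullet> (p v - p u)) - 2 * 0 * (?n v c \<bullet> e u b)) (at_right 0)"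
      by (intro tendsto_intros)
    have pos: "(1/2 - 0) * (?n v c \<bullet> (p v - p u)) - 2 * 0 * (?n v c \<bullet> e u b) > 0" if "u \<noteq> v"
      using \<epsilon>(2)[OF uv(1,2,4) that] by simp
    show "\<forall>\<^sub>F \<delta> in at_right 0. u \<noteq> v \<longrightarrow>
        0 < (1/2 - \<delta>) * (?n v c \<bullet> (p v - p u)) - 2 * \<delta> * (?n v c \<bullet> e u b)"
    proof (cases "u = v")
      case False
      from order_tendstoD(1)[OF lim pos[OF False]] show ?thesis
        by (rule eventually_mono) blast
    qed simp
  qed
  moreover have "\<forall>\<^sub>F \<delta> in at_right 0. (0::real) < \<delta> \<and> \<delta> < 1/2"
    using eventually_at_right_real[of 0 "1/2"] by simp
  ultimately have "\<forall>\<^sub>F \<delta> in at_right 0. (0 < \<delta> \<and> \<delta> < 1/2) \<and>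
      (\<forall>u\<in>N. \<forall>v\<in>N. \<forall>b\<in>Basis. \<forall>c\<in>Basis. u \<noteq> v \<longrightarrow>
        0 < (1/2 - \<delta>) * (?n v c \<bullet> (p v - p u)) - 2 * \<delta> * (?n v c \<bullet> e u b))"
    by (rule eventually_conj[rotated])
  then obtain \<delta> :: real where \<delta>: "0 < \<delta>" "\<delta> < 1/2"
    "\<And>u v b c. u \<in> N \<Longrightarrow> v \<in> N \<Longrightarrow> b \<in> Basis \<Longrightarrow> c \<in> Basis \<Longrightarrow> u \<noteq> v \<Longrightarrow>
        0 < (1/2 - \<delta>) * (?n v c \<bullet> (p v - p u)) - 2 * \<delta> * (?n v c \<bullet> e u b)"
    using eventually_happens'[OF trivial_limit_at_right_real] by blast
  define r where "r = 1/2 - \<delta>"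
  have r: "0 < r"
    using \<delta>(2) by (simp add: r_def)
  define S where "S = (\<lambda>(v, c). {x. ?n v c \<bullet> x \<le> r * (?n v c \<bullet> p v)})"
  show thesis
  proof
    show "convex (S q)" for q
      by (cases q) (simp add: S_def convex_halfspace_le)
  next
    fix q assume "q \<in> N \<times> (Basis :: 'a set)"
    then obtain u b where q: "q = (u, b)" "u \<in> N" "b \<in> Basis"
      by auto
    \<comment> \<open>The apex over \<open>- u\<close> and a point beyond the apex over \<open>u\<close>; the step length \<open>2 * \<delta>\<close> makes up
      exactly for the two shrunk distances \<open>1/2 - \<delta>\<close>.\<close>
    define x where "x = r *\<^sub>R p u + (2 * \<delta>) *\<^sub>R e u b"
    define y where "y = r *\<^sub>R p (- u)"
    have x: "x \<in> S (v, c)" if vc: "v \<in> N" "c \<in> Basis" "(v, c) \<noteq> q" for v c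
    proof (cases "v = u")
      case True
      then show ?thesis
        using e(2)[OF q(2,3), of c] vc q(1) by (simp add: S_def x_def inner_add_right)
    next
      case False
      then show ?thesis
        using \<delta>(3)[OF q(2) vc(1) q(3) vc(2)]
        by (auto simp: S_def x_def inner_add_right inner_diff_right r_def algebra_simps)
    qed
    have y: "y \<in> S (v, c)" if vc: "v \<in> N" "c \<in> Basis" for v c
    proof (cases "v = - u")
      case False
      then have "?n v c \<bullet> p (- u) \<le> ?n v c \<bullet> p v"
        using \<epsilon>(2)[OF N(3)[OF q(2)] vc] by (auto simp: inner_diff_right)
      then show ?thesis
        using r by (simp add: S_def y_def)
    qed (simp add: S_def y_def)
    have "u \<bullet> p (- u) = - 1"
      using p(1)[OF N(3)[OF q(2)]] by simp
    then have "u \<bullet> (x - y) = 1"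
      using p(1)[OF q(2)] e(1)[OF q(2,3)]
      by (simp add: x_def y_def inner_diff_right inner_add_right r_def)
    then have "1 \<le> ereal (\<rho> (x - y))"
      using \<rho>_ge[OF q(2), of "x - y"] by simp
    also have "\<dots> \<le> norm_diameter \<rho> (\<Inter>(S ` (N \<times> Basis - {q})))"
      using x y by (intro norm_diameter_ge) auto
    finally show "norm_diameter \<rho> (\<Inter>(S ` (N \<times> Basis - {q}))) \<ge> 1" .
  next
    have le: "u \<bullet> x \<le> r" if "u \<in> N" and x: "x \<in> \<Inter>(S ` (N \<times> Basis))" for u x
    proof -
      have "real DIM('a) * (u \<bullet> x) = (\<Sum>b\<in>Basis. ?n u b \<bullet> x)"
        by (simp add: sum_tilted_normal flip: inner_sum_left)
      also have "\<dots> \<le> (\<Sum>b\<in>Basis. r * (?n u b \<bullet> p u))"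
        using that by (intro sum_mono) (auto simp: S_def)
      also have "\<dots> = real DIM('a) * r"
        using p(1)[OF that(1)]
        by (simp add: sum_tilted_normal flip: sum_distrib_left inner_sum_left)
      finally show ?thesis by simp
    qed
    have "\<rho> (x - y) \<le> 2 * r"
      if "x \<in> \<Inter>(S ` (N \<times> Basis))" "y \<in> \<Inter>(S ` (N \<times> Basis))" for x y
    proof (rule \<rho>_le)
      fix u assume "u \<in> N"
      then show "u \<bullet> (x - y) \<le> 2 * r"
        using le[of u x] le[of "- u" y] N(3) that by (simp add: inner_diff_right)
    qed
    then have "norm_diameter \<rho> (\<Inter>(S ` (N \<times> Basis))) \<le> ereal (2 * r)"
      unfolding norm_diameter_def by (intro SUP_least) auto
    also have "\<dots> < 1"
      using \<delta>(1) by (simp add: r_def)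
    finally show "norm_diameter \<rho> (\<Inter>(S ` (N \<times> Basis))) < 1" .
  qed
qed

section \<open>Colourful diameter theorem for polytopal norms\<close>

theorem theorem3p4:
  fixes K :: "'a::euclidean_space set" and \<rho> :: "'a \<Rightarrow> real" and d k :: nat
  assumes "symmetric_convex_body K"
    and "\<rho> = minkowski_norm K"
    and "polytope K"
    and "card {S. S facet_of K} = k"
    and "d = DIM('a)"
  shows "(\<forall>\<F> :: nat \<Rightarrow> 'a set set.
            (\<forall>i\<in>{1..k * d}. finite (\<F> i) \<and> (\<forall>A\<in>\<F> i. convex A)) \<longrightarrow>
            (\<forall>F. (\<forall>i\<in>{1..k * d}. F i \<in> \<F> i) \<longrightarrow>
                 norm_diameter \<rho> (\<Inter>i\<in>{1..k * d}. F i) \<ge> 1) \<longrightarrow>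
            (\<exists>l\<in>{1..k * d}. norm_diameter \<rho> (\<Inter>(\<F> l)) \<ge> 1)) \<and>
         (\<exists>\<F> :: nat \<Rightarrow> 'a set set.
            (\<forall>i\<in>{1..k * d - 1}. finite (\<F> i) \<and> (\<forall>A\<in>\<F> i. convex A)) \<and>
            (\<forall>F. (\<forall>i\<in>{1..k * d - 1}. F i \<in> \<F> i) \<longrightarrow>
                 norm_diameter \<rho> (\<Inter>i\<in>{1..k * d - 1}. F i) \<ge> 1) \<and>
            (\<forall>l\<in>{1..k * d - 1}. norm_diameter \<rho> (\<Inter>(\<F> l)) < 1))"
proof -
  obtain N where N: "finite N" "card N = k" "\<And>u. u \<in> N \<Longrightarrow> u \<noteq> 0" "\<And>u. u \<in> N \<Longrightarrow> - u \<in> N"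
    and K: "K = {x. \<forall>u\<in>N. u \<bullet> x \<le> 1}"
    and facet: "\<And>u. u \<in> N \<Longrightarrow> \<exists>p. u \<bullet> p = 1 \<and> (\<forall>v\<in>N - {u}. v \<bullet> p < 1)"
    using facet_normals_exist[OF assms(1,3), unfolded assms(4)] by blast
  have bd: "bounded K"
    using assms(3) by (rule polytope_imp_bounded)
  have ne: "N \<noteq> {}" and \<rho>: "\<rho> z = Max ((\<lambda>u. u \<bullet> z) ` N)" for z
    using minkowski_norm_eq_Max[OF bd N(1,4) K] assms(2) by auto
  have \<rho>_ge: "u \<bullet> z \<le> \<rho> z" if "u \<in> N" for u z
    unfolding \<rho> using that N(1) by (intro Max_ge) auto
  have \<rho>_le: "\<rho> z \<le> c" if "\<And>u. u \<in> N \<Longrightarrow> u \<bullet> z \<le> c" for z c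
    unfolding \<rho> using that N(1) ne by simp
  have pos: "0 < k * d"
    using N(1,2) ne assms(5) by (auto simp: card_gt_0_iff)
  show ?thesis
  proof (intro conjI allI impI)
    fix \<F> :: "nat \<Rightarrow> 'a set set"
    assume \<F>: "\<forall>i\<in>{1..k * d}. finite (\<F> i) \<and> (\<forall>A\<in>\<F> i. convex A)"
      and trans: "\<forall>F. (\<forall>i\<in>{1..k * d}. F i \<in> \<F> i) \<longrightarrow>
        norm_diameter \<rho> (\<Inter>i\<in>{1..k * d}. F i) \<ge> 1"
    show "\<exists>l\<in>{1..k * d}. norm_diameter \<rho> (\<Inter>(\<F> l)) \<ge> 1"
    proof (rule colourful_diameter[OF N(1,3,4) \<rho>_ge \<rho>_le])
      show "card {1..k * d} = card N * DIM('a)"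
        using N(2) assms(5) by simp
    qed (use \<F> trans in auto)
  next
    obtain S :: "'a \<times> 'a \<Rightarrow> 'a set" where conv: "\<And>q. convex (S q)"
      and crit: "\<And>q. q \<in> N \<times> Basis \<Longrightarrow> norm_diameter \<rho> (\<Inter>(S ` (N \<times> Basis - {q}))) \<ge> 1"
      and small: "norm_diameter \<rho> (\<Inter>(S ` (N \<times> Basis))) < 1"
      using critical_halfspaces[OF N(1,3,4) \<rho>_ge \<rho>_le facet] by blast
    have card: "card (N \<times> (Basis :: 'a set)) = k * d"
      using N(2) assms(5) by (simp add: card_cartesian_product)
    \<comment> \<open>With one colour too few, a transversal of copies of the same family misses a halfspace.\<close>
    have "norm_diameter \<rho> (\<Inter>i\<in>{1..k * d - 1}. F i) \<ge> 1"
      if F: "\<forall>i\<in>{1..k * d - 1}. F i \<in> S ` (N \<times> Basis)" for F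
    proof -
      obtain g where g: "\<And>i. i \<in> {1..k * d - 1} \<Longrightarrow> g i \<in> N \<times> Basis \<and> F i = S (g i)"
      proof -
        have "\<forall>i\<in>{1..k * d - 1}. \<exists>q. q \<in> N \<times> Basis \<and> F i = S q"
          using F by blast
        then show ?thesis
          using bchoice[of "{1..k * d - 1}" "\<lambda>i q. q \<in> N \<times> Basis \<and> F i = S q"] that by blast
      qed
      have "card (g ` {1..k * d - 1}) \<le> k * d - 1"
        using card_image_le[of "{1..k * d - 1}" g] by simp
      then have "card (g ` {1..k * d - 1}) < card (N \<times> (Basis :: 'a set))"
        using pos card by linarith
      then have "\<not> N \<times> Basis \<subseteq> g ` {1..k * d - 1}"
        by (meson card_mono finite_atLeastAtMost finite_imageI not_le)
      then obtain q where q: "q \<in> N \<times> Basis" "q \<notin> g ` {1..k * d - 1}"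
        by blast
      have "1 \<le> norm_diameter \<rho> (\<Inter>(S ` (N \<times> Basis - {q})))"
        using crit[OF q(1)] .
      also have "\<dots> \<le> norm_diameter \<rho> (\<Inter>i\<in>{1..k * d - 1}. F i)"
        using g q(2) by (intro norm_diameter_mono) blast
      finally show ?thesis .
    qed
    then show "\<exists>\<F> :: nat \<Rightarrow> 'a set set.
        (\<forall>i\<in>{1..k * d - 1}. finite (\<F> i) \<and> (\<forall>A\<in>\<F> i. convex A)) \<and>
        (\<forall>F. (\<forall>i\<in>{1..k * d - 1}. F i \<in> \<F> i) \<longrightarrow>
             norm_diameter \<rho> (\<Inter>i\<in>{1..k * d - 1}. F i) \<ge> 1) \<and>
        (\<forall>l\<in>{1..k * d - 1}. norm_diameter \<rho> (\<Inter>(\<F> l)) < 1)"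
      using conv small N(1) by (intro exI[of _ "\<lambda>_. S ` (N \<times> Basis)"]) auto
  qed
qed

end
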